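(* Let $G=(V,w,m)$ be a graph with at least two vertices and let $x_0\in V$. If $S_R\neq\emptyset$ for $R>0$ (an integer), then $$\sum_{r=1}^R\kappa(r)\le\mathrm{Deg}(x_0)+\min_{x\in S_R}\left(\mathrm{Deg}_-(x)-\mathrm{Deg}_+(x)\right).$$ In particular, if $M\in\mathbb R$ and $K>0$ are such that $\min_{x\in S_r}(\mathrm{Deg}_-(x)-\mathrm{Deg}_+(x))\le M$ and $\kappa(r)\ge K>0$ for all $r\ge1$ with $S_r\ne\emptyset$, then $$\mathrm{diam}(G)\le\frac{2(\mathrm{Deg}(x_0)+M)}{K}.$$
   Context: A graph is a triple $G=(V,w,m)$ with $V$ a countable set, $w:V\times V\to[0,\infty)$ symmetric and zero on the diagonal, and $m:V\to(0,\infty)$. Write $x\sim y$ if $w(x,y)>0$. All graphs are locally finite (for each $x$ only finitely many $y$ satisfy $x\sim y$) and connected; $d(x,y)=\inf\{n: x=x_0\sim\cdots\sim x_n=y\}$ is the combinatorial distance, which is finite by connectedness, and $\mathrm{diam}(G)=\sup_{x,y}d(x,y)$. Let $S_r=\{y: d(x_0,y)=r\}$. $\mathrm{Deg}(x)=\frac1{m(x)}\sum_{y}w(x,y)$, and for $x\in S_r$, $\mathrm{Deg}_{\pm}(x)=\frac1{m(x)}\sum_{y\in S_{r\pm1}}w(x,y)$. $Lip(1)$ is the set of $f:V\to\mathbb R$ with $|f(x)-f(y)|\le d(x,y)$ for all $x,y$. Curvature: for $x\in V$ and $\varepsilon>0$ let $m_x^\varepsilon(x)=1-\varepsilon\,\mathrm{Deg}(x)$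 and $m_x^\varepsilon(y)=\varepsilon w(x,y)/m(x)$ for $y\neq x$; this is a finitely supported probability measure for $\varepsilon$ small. For probability measures $\mu,\nu$ on $V$, $W(\mu,\nu)=\sup_{f}\sum_{x}f(x)(\mu(x)-\nu(x))$, the supremum over bounded $f\in Lip(1)$. For $x\neq y$ let $\kappa_\varepsilon(x,y)=1-\frac{W(m_x^\varepsilon,m_y^\varepsilon)}{d(x,y)}$ and $\kappa(x,y)=\lim_{\varepsilon\to0^+}\frac1\varepsilon\kappa_\varepsilon(x,y)$ (this limit exists). Sphere curvatures with respect to $x_0$: for $r\ge1$ with $S_r\ne\emptyset$, $\kappa(r)=\min_{y\in S_r}\max_{x\in S_{r-1},\,x\sim y}\kappa(x,y)$. *)

theory Defs
  imports "HOL-Analysis.Analysis"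
begin

record 'a wgraph =
  verts :: "'a set"
  weight :: "'a \<Rightarrow> 'a \<Rightarrow> real"
  mass :: "'a \<Rightarrow> real"

definition adj :: "'a wgraph \<Rightarrow> 'a \<Rightarrow> 'a \<Rightarrow> bool" where
  "adj G x y \<longleftrightarrow> x \<in> verts G \<and> y \<in> verts G \<and> weight G x y > 0"

definition walk :: "'a wgraph \<Rightarrow> 'a \<Rightarrow> 'a \<Rightarrow> nat \<Rightarrow> bool" where
  "walk G x y n \<longleftrightarrow> (\<exists>p. p 0 = x \<and> p n = y \<and> (\<forall>i<n. adj G (p i) (p (Suc i))))"

text \<open>Standing assumptions: all graphs are locally finite and connected.
  The values of the weight and of the mass outside the vertex set are irrelevant.\<close>

locale weighted_graph =
  fixes G :: "'a wgraph"
  assumes countable_verts: "countable (verts G)"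
    and weight_nonneg: "\<lbrakk>x \<in> verts G; y \<in> verts G\<rbrakk> \<Longrightarrow> weight G x y \<ge> 0"
    and weight_sym: "\<lbrakk>x \<in> verts G; y \<in> verts G\<rbrakk> \<Longrightarrow> weight G x y = weight G y x"
    and weight_diag: "x \<in> verts G \<Longrightarrow> weight G x x = 0"
    and mass_pos: "x \<in> verts G \<Longrightarrow> mass G x > 0"
    and locally_finite: "x \<in> verts G \<Longrightarrow> finite {y. adj G x y}"
    and connected: "\<lbrakk>x \<in> verts G; y \<in> verts G\<rbrakk> \<Longrightarrow> \<exists>n. walk G x y n"

text \<open>The infimum is over a nonempty set of natural numbers whenever \<open>x\<close>, \<open>y\<close> are vertices of a
  connected graph.\<close>

definition gdist :: "'a wgraph \<Rightarrow> 'a \<Rightarrow> 'a \<Rightarrow> nat" where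
  "gdist G x y = Inf {n. walk G x y n}"

definition diam :: "'a wgraph \<Rightarrow> ereal" where
  "diam G = (SUP x\<in>verts G. SUP y\<in>verts G. ereal (real (gdist G x y)))"

definition gsphere :: "'a wgraph \<Rightarrow> 'a \<Rightarrow> nat \<Rightarrow> 'a set" where
  "gsphere G x0 r = {y \<in> verts G. gdist G x0 y = r}"

definition Deg :: "'a wgraph \<Rightarrow> 'a \<Rightarrow> real" where
  "Deg G x = (\<Sum>\<^sub>\<infinity>y\<in>verts G. weight G x y) / mass G x"

definition Deg_plus :: "'a wgraph \<Rightarrow> 'a \<Rightarrow> 'a \<Rightarrow> real" where
  "Deg_plus G x0 x = (\<Sum>\<^sub>\<infinity>y\<in>gsphere G x0 (gdist G x0 x + 1). weight G x y) / mass G x"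

text \<open>The index set is the sphere of radius \<open>r - 1\<close>, where \<open>r\<close> is the distance from \<open>x0\<close> to \<open>x\<close>;
  it is written without truncated subtraction so that it is empty for \<open>r = 0\<close>.\<close>

definition Deg_minus :: "'a wgraph \<Rightarrow> 'a \<Rightarrow> 'a \<Rightarrow> real" where
  "Deg_minus G x0 x =
     (\<Sum>\<^sub>\<infinity>y\<in>{y \<in> verts G. gdist G x0 y + 1 = gdist G x0 x}. weight G x y) / mass G x"

definition Lip1 :: "'a wgraph \<Rightarrow> ('a \<Rightarrow> real) set" where
  "Lip1 G = {f. \<forall>x\<in>verts G. \<forall>y\<in>verts G. \<bar>f x - f y\<bar> \<le> real (gdist G x y)}"

definition walk_measure :: "'a wgraph \<Rightarrow> real \<Rightarrow> 'a \<Rightarrow> 'a \<Rightarrow> real" where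
  "walk_measure G \<epsilon> x y =
     (if y = x then 1 - \<epsilon> * Deg G x else \<epsilon> * weight G x y / mass G x)"

text \<open>Measures on the vertex set are given by their point masses. For finitely supported arguments
  of equal total mass, such as those below, the supremum is over a set that is bounded above.\<close>

definition wasserstein :: "'a wgraph \<Rightarrow> ('a \<Rightarrow> real) \<Rightarrow> ('a \<Rightarrow> real) \<Rightarrow> real" where
  "wasserstein G \<mu> \<nu> =
     (SUP f\<in>{f \<in> Lip1 G. bounded (f ` verts G)}. \<Sum>\<^sub>\<infinity>x\<in>verts G. f x * (\<mu> x - \<nu> x))"

definition curvature_eps :: "'a wgraph \<Rightarrow> real \<Rightarrow> 'a \<Rightarrow> 'a \<Rightarrow> real" where
  "curvature_eps G \<epsilon> x y =
     1 - wasserstein G (walk_measure G \<epsilon> x) (walk_measure G \<epsilon> y) / real (gdist G x y)"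

definition curvature :: "'a wgraph \<Rightarrow> 'a \<Rightarrow> 'a \<Rightarrow> real" where
  "curvature G x y = Lim (at_right 0) (\<lambda>\<epsilon>. 1 / \<epsilon> * curvature_eps G \<epsilon> x y)"

text \<open>Meaningful for \<open>r \<ge> 1\<close> and a nonempty sphere of radius \<open>r\<close>; then both the minimum and the
  maxima are over finite nonempty sets, since spheres of a locally finite graph are finite.\<close>

definition sphere_curvature :: "'a wgraph \<Rightarrow> 'a \<Rightarrow> nat \<Rightarrow> real" where
  "sphere_curvature G x0 r =
     (MIN y\<in>gsphere G x0 r. MAX x\<in>{x \<in> gsphere G x0 (r - 1). adj G x y}. curvature G x y)"

end

theory Submission imports Defs begin

text \<open>Testing the Wasserstein distance with the (truncated) distance function \<open>f = d(x0, \<cdot>)\<close> bounds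
  \<open>\<kappa>(x, y)\<close> by \<open>\<Delta>f(x) - \<Delta>f(y)\<close> whenever \<open>x \<in> S\<^bsub>r-1\<^esub>\<close> and \<open>y \<in> S\<^sub>r\<close> are adjacent, where
  \<open>\<Delta>f = Deg\<^sub>+ - Deg\<^sub>-\<close>.  The limit defining \<open>\<kappa>\<close> exists because the Wasserstein distance is convex in
  \<open>\<epsilon>\<close>, which makes \<open>\<kappa>\<^sub>\<epsilon>/\<epsilon>\<close> monotone.  Descending from a point of \<open>S\<^sub>R\<close> to \<open>x0\<close> along neighbours that
  maximise the curvature, these bounds telescope.\<close>

definition laplacian :: "'a wgraph \<Rightarrow> ('a \<Rightarrow> real) \<Rightarrow> 'a \<Rightarrow> real" where
  "laplacian G f x = (\<Sum>y | adj G x y. weight G x y * (f y - f x)) / mass G x"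

lemma laplacian_uminus: "laplacian G (\<lambda>z. - f z) x = - laplacian G f x"
  by (simp add: laplacian_def right_diff_distrib sum_subtractf sum_negf diff_divide_distrib)

text \<open>A value close to the supremum, taken at \<open>t\<close>, cannot decrease on moving
  towards \<open>a\<close>. This supplies the limit in \<open>curvature\<close>, where
  \<open>Lim\<close> is informative only once convergence is known.\<close>

lemma tendsto_at_right_SUP_antimono:
  fixes k :: "real \<Rightarrow> real"
  assumes anti: "\<And>s t. \<lbrakk>a < s; s \<le> t\<rbrakk> \<Longrightarrow> k t \<le> k s"
    and bdd: "\<And>s. a < s \<Longrightarrow> k s \<le> c"
  shows "(k \<longlongrightarrow> (SUP s\<in>{a<..}. k s)) (at_right a)"
proof (rule order_tendstoI)
  have B: "bdd_above (k ` {a<..})" using bdd by (auto intro!: bdd_aboveI[of _ c])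
  fix u
  { assume "u < (SUP s\<in>{a<..}. k s)"
    then obtain t where t: "t > a" "u < k t"
      using less_cSUP_iff[OF _ B, of u] by auto
    show "\<forall>\<^sub>F s in at_right a. u < k s"
      unfolding eventually_at_right_field
      using t anti by (intro exI[of _ t]) (auto intro: less_le_trans) }
  { assume u: "(SUP s\<in>{a<..}. k s) < u"
    have "k s < u" if "s > a" for s
      using cSUP_upper[OF _ B, of s] that u by auto
    then show "\<forall>\<^sub>F s in at_right a. k s < u"
      unfolding eventually_at_right_field by (auto intro: exI[of _ "a + 1"]) }
qed

section \<open>Walks, combinatorial distance and spheres\<close>

lemma walk_trans:
  assumes "walk G x y m" "walk G y z n"
  shows "walk G x z (m + n)"
proof -
  obtain p q where p: "p 0 = x" "p m = y" "\<forall>i<m. adj G (p i) (p (Suc i))"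
    and q: "q 0 = y" "q n = z" "\<forall>i<n. adj G (q i) (q (Suc i))"
    using assms unfolding walk_def by blast
  let ?r = "\<lambda>i. if i \<le> m then p i else q (i - m)"
  have "adj G (?r i) (?r (Suc i))" if "i < m + n" for i
  proof -
    consider "i < m" | "i = m" | "i > m" by linarith
    then show ?thesis
    proof cases
      case 2
      with p(2) q(1,3) that show ?thesis by force
    next
      case 3
      with q(3)[rule_format, of "i - m"] that show ?thesis by (simp add: Suc_diff_le)
    qed (use p(3) in auto)
  qed
  moreover have "?r 0 = x" "?r (m + n) = z" using p q by auto
  ultimately show ?thesis unfolding walk_def by (intro exI[of _ ?r]) blast
qed

lemma walk_adj: "adj G x y \<Longrightarrow> walk G x y 1"
  unfolding walk_def by (intro exI[of _ "\<lambda>i. if i = 0 then x else y"]) auto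

lemma gdist_le: "walk G x y n \<Longrightarrow> gdist G x y \<le> n"
  unfolding gdist_def by (simp add: cInf_lower)

context weighted_graph
begin

lemma adj_sym: "adj G x y \<Longrightarrow> adj G y x"
  by (simp add: adj_def weight_sym)

lemma walk_sym:
  assumes "walk G x y n" shows "walk G y x n"
proof -
  obtain p where p: "p 0 = x" "p n = y" "\<forall>i<n. adj G (p i) (p (Suc i))"
    using assms unfolding walk_def by blast
  have "adj G (p (n - i)) (p (n - Suc i))" if "i < n" for i
    using p(3)[rule_format, of "n - Suc i"] that by (simp add: Suc_diff_Suc adj_sym)
  with p show ?thesis unfolding walk_def by (intro exI[of _ "\<lambda>i. p (n - i)"]) auto
qed

text \<open>Connectedness makes the set of walk lengths nonempty, so its infimum in the natural
  numbers is attained.\<close>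

lemma walk_gdist: "\<lbrakk>x \<in> verts G; y \<in> verts G\<rbrakk> \<Longrightarrow> walk G x y (gdist G x y)"
  using connected Inf_nat_def1[of "{n. walk G x y n}"] unfolding gdist_def by auto

lemma gdist_triangle:
  "\<lbrakk>x \<in> verts G; y \<in> verts G; z \<in> verts G\<rbrakk> \<Longrightarrow> gdist G x z \<le> gdist G x y + gdist G y z"
  by (meson gdist_le walk_gdist walk_trans)

lemma gdist_sym: "\<lbrakk>x \<in> verts G; y \<in> verts G\<rbrakk> \<Longrightarrow> gdist G x y = gdist G y x"
  by (meson antisym gdist_le walk_gdist walk_sym)

lemma gdist_self [simp]: "gdist G x x = 0"
proof -
  have "walk G x x 0" by (auto simp: walk_def)
  then show ?thesis using gdist_le by fastforce
qed

lemma gdist_eq_0_iff: "\<lbrakk>x \<in> verts G; y \<in> verts G\<rbrakk> \<Longrightarrow> gdist G x y = 0 \<longleftrightarrow> x = y"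
  using walk_gdist[of x y] by (auto simp: walk_def)

lemma gdist_adj:
  assumes "adj G x y" shows "gdist G x y = 1"
proof -
  have "x \<in> verts G" "y \<in> verts G" "x \<noteq> y"
    using assms weight_diag by (auto simp: adj_def)
  then show ?thesis
    using gdist_le[OF walk_adj[OF assms]] gdist_eq_0_iff[of x y] by linarith
qed

lemma gdist_adj_le:
  "\<lbrakk>x0 \<in> verts G; adj G x y\<rbrakk> \<Longrightarrow> gdist G x0 y \<le> gdist G x0 x + 1"
  using gdist_triangle[of x0 x y] gdist_adj[of x y] by (simp add: adj_def)

text \<open>Take the penultimate vertex of a shortest walk: dropping the last edge gives distance at
  most \<open>r\<close>, and one edge raises the distance by at most 1.\<close>

lemma gsphere_predecessor:
  assumes x0: "x0 \<in> verts G" and y: "y \<in> gsphere G x0 (Suc r)"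
  obtains x where "x \<in> gsphere G x0 r" "adj G x y"
proof -
  have yv: "y \<in> verts G" and d: "gdist G x0 y = Suc r" using y by (auto simp: gsphere_def)
  have "walk G x0 y (Suc r)" using walk_gdist[OF x0 yv] d by simp
  then obtain p where p: "p 0 = x0" "p (Suc r) = y" "\<forall>i<Suc r. adj G (p i) (p (Suc i))"
    unfolding walk_def by blast
  then have "walk G x0 (p r) r" unfolding walk_def by (intro exI[of _ p]) auto
  then have le: "gdist G x0 (p r) \<le> r" by (rule gdist_le)
  have a: "adj G (p r) y" using p by auto
  with gdist_adj_le[OF x0 a] d le have "p r \<in> gsphere G x0 r"
    by (auto simp: gsphere_def adj_def)
  with a that show ?thesis by blast
qed

text \<open>Each sphere consists of neighbours of the preceding one, so local finiteness propagates
  outwards. The minima and maxima over spheres are thereby attained.\<close>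

lemma finite_gsphere:
  assumes x0: "x0 \<in> verts G" shows "finite (gsphere G x0 r)"
proof (induction r)
  case 0
  have "gsphere G x0 0 \<subseteq> {x0}" using x0 gdist_eq_0_iff by (auto simp: gsphere_def)
  then show ?case using finite_subset by blast
next
  case (Suc r)
  have "gsphere G x0 (Suc r) \<subseteq> (\<Union>x\<in>gsphere G x0 r. {y. adj G x y})"
    using gsphere_predecessor[OF x0] by blast
  moreover have "finite (\<Union>x\<in>gsphere G x0 r. {y. adj G x y})"
    using Suc locally_finite by (auto simp: gsphere_def)
  ultimately show ?case using finite_subset by blast
qed

section \<open>Degrees and the Laplacian of the distance function\<close>

lemma infsum_weight:
  assumes x: "x \<in> verts G" and A: "A \<subseteq> verts G"
  shows "(\<Sum>\<^sub>\<infinity>y\<in>A. weight G x y) = (\<Sum>y | adj G x y. if y \<in> A then weight G x y else 0)"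
proof -
  have "(\<Sum>\<^sub>\<infinity>y\<in>A. weight G x y) =
      (\<Sum>\<^sub>\<infinity>y\<in>{y. adj G x y}. if y \<in> A then weight G x y else 0)"
  \<comment> \<open>Weights vanish off the neighbours of \<open>x\<close>. The indicator form gives
    sums over different spheres one common finite index set, so they can be subtracted
    termwise.\<close>
  proof (rule infsum_cong_neutral)
    fix y assume "y \<in> A - {y. adj G x y}"
    with x A weight_nonneg[of x y] show "weight G x y = 0"
      by (force simp: adj_def)
  qed auto
  with locally_finite[OF x] show ?thesis by simp
qed

lemma Deg_eq: "x \<in> verts G \<Longrightarrow> Deg G x = (\<Sum>y | adj G x y. weight G x y) / mass G x"
  unfolding Deg_def by (subst infsum_weight) (auto simp: adj_def intro!: sum.cong)

text \<open>A 1-Lipschitz function changes by at most 1 along an edge. The bound is uniform in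
  \<open>f\<close>, which later bounds the Wasserstein supremum.\<close>

lemma abs_laplacian_le_Deg:
  assumes x: "x \<in> verts G" and f: "f \<in> Lip1 G"
  shows "\<bar>laplacian G f x\<bar> \<le> Deg G x"
proof -
  have "\<bar>\<Sum>y | adj G x y. weight G x y * (f y - f x)\<bar> \<le>
      (\<Sum>y | adj G x y. \<bar>weight G x y * (f y - f x)\<bar>)"
    by (rule sum_abs)
  also have "\<dots> \<le> (\<Sum>y | adj G x y. weight G x y)"
  proof (rule sum_mono)
    fix y assume y: "y \<in> {y. adj G x y}"
    then have "\<bar>f y - f x\<bar> \<le> 1"
      using f gdist_adj[OF adj_sym, of x y] by (fastforce simp: Lip1_def adj_def)
    with y show "\<bar>weight G x y * (f y - f x)\<bar> \<le> weight G x y"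
      by (simp add: adj_def abs_mult mult_left_le)
  qed
  finally show ?thesis
    using mass_pos[OF x] by (simp add: laplacian_def Deg_eq[OF x] divide_right_mono)
qed

text \<open>Along an edge the distance from \<open>x0\<close> changes by 1, 0 or -1: outward edges
  count positively, inward ones negatively, and edges inside a sphere drop out.\<close>

lemma laplacian_gdist:
  assumes x0: "x0 \<in> verts G" and x: "x \<in> verts G"
  shows "laplacian G (\<lambda>z. real (gdist G x0 z)) x = Deg_plus G x0 x - Deg_minus G x0 x"
proof -
  let ?d = "gdist G x0"
  let ?P = "gsphere G x0 (?d x + 1)" and ?M = "{y \<in> verts G. ?d y + 1 = ?d x}"
  have "(\<Sum>y | adj G x y. weight G x y * (real (?d y) - real (?d x))) =
      (\<Sum>y | adj G x y. (if y \<in> ?P then weight G x y else 0) - (if y \<in> ?M then weight G x y else 0))"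
  proof (rule sum.cong[OF refl])
    fix y assume y: "y \<in> {y. adj G x y}"
    then have "?d y \<le> ?d x + 1" "?d x \<le> ?d y + 1" "y \<in> verts G"
      using gdist_adj_le[OF x0, of x y] gdist_adj_le[OF x0 adj_sym, of x y] by (auto simp: adj_def)
    then consider "?d y = ?d x + 1" | "?d y = ?d x" | "?d y + 1 = ?d x" by linarith
    then show "weight G x y * (real (?d y) - real (?d x)) =
        (if y \<in> ?P then weight G x y else 0) - (if y \<in> ?M then weight G x y else 0)"
      using \<open>y \<in> verts G\<close>
    proof cases
      case 3
      then have "real (?d x) = real (?d y) + 1" by simp
      with 3 \<open>y \<in> verts G\<close> show ?thesis by (auto simp: gsphere_def)
    qed (auto simp: gsphere_def algebra_simps)
  qed
  also have "\<dots> = (\<Sum>\<^sub>\<infinity>y\<in>?P. weight G x y) - (\<Sum>\<^sub>\<infinity>y\<in>?M. weight G x y)"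
    by (subst (1 2) infsum_weight[OF x]) (auto simp: gsphere_def sum_subtractf)
  finally show ?thesis
    by (simp add: laplacian_def Deg_plus_def Deg_minus_def diff_divide_distrib)
qed

text \<open>Every neighbour of \<open>x0\<close> lies at distance 1. With
  \<open>Deg_minus_center\<close> this gives the value at which the telescoping ends.\<close>

lemma Deg_plus_center: "x0 \<in> verts G \<Longrightarrow> Deg_plus G x0 x0 = Deg G x0"
  unfolding Deg_plus_def
  by (subst infsum_weight)
     (auto simp: gsphere_def adj_def Deg_eq gdist_adj intro!: sum.cong arg_cong2[of _ _ _ _ "(/)"])

lemma Deg_minus_center: "Deg_minus G x0 x0 = 0"
  by (simp add: Deg_minus_def)

section \<open>Transport between one-step measures\<close>

lemma has_sum_walk_measure:
  assumes x: "x \<in> verts G"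
  shows "((\<lambda>z. f z * walk_measure G \<epsilon> x z) has_sum f x + \<epsilon> * laplacian G f x) (verts G)"
proof -
  let ?N = "{y. adj G x y}" and ?g = "\<lambda>z. f z * walk_measure G \<epsilon> x z"
  have fin: "finite ?N" and xN: "x \<notin> ?N" using locally_finite[OF x] weight_diag by (auto simp: adj_def)
  \<comment> \<open>The zero diagonal keeps \<open>x\<close> out of \<open>?N\<close>, so its mass
    splits off. The computation is algebraic and covers every real \<open>\<epsilon>\<close>, as the
    monotonicity argument over all positive \<open>\<epsilon>\<close> requires.\<close>
  have "sum ?g (insert x ?N) = f x * (1 - \<epsilon> * Deg G x) + (\<Sum>z\<in>?N. f z * (\<epsilon> * weight G x z / mass G x))"
    using fin xN by (auto simp: walk_measure_def intro!: sum.cong)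
  also have "\<dots> = f x + \<epsilon> * laplacian G f x"
    by (simp add: laplacian_def Deg_eq[OF x] right_diff_distrib sum_subtractf diff_divide_distrib
        sum_distrib_left sum_distrib_right sum_divide_distrib mult_ac)
  finally have "(?g has_sum f x + \<epsilon> * laplacian G f x) (insert x ?N)"
    using has_sum_finite[of "insert x ?N" ?g] fin by simp
  moreover have "walk_measure G \<epsilon> x z = 0" if "z \<in> verts G - insert x ?N" for z
    using that x weight_nonneg[of x z] by (force simp: adj_def walk_measure_def)
  ultimately show ?thesis
    using x by (subst has_sum_cong_neutral[where T = "insert x ?N" and g = ?g])
      (auto simp: adj_def[abs_def])
qed

text \<open>Each test function contributes a function affine in \<open>\<epsilon>\<close>; this is
  the source of the convexity of the distance.\<close>

lemma wasserstein_walk_measure: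
  assumes "x \<in> verts G" "y \<in> verts G"
  shows "wasserstein G (walk_measure G \<epsilon> x) (walk_measure G \<epsilon> y) =
    (SUP f\<in>{f \<in> Lip1 G. bounded (f ` verts G)}.
       f x - f y + \<epsilon> * (laplacian G f x - laplacian G f y))"
proof -
  have "(\<Sum>\<^sub>\<infinity>z\<in>verts G. f z * (walk_measure G \<epsilon> x z - walk_measure G \<epsilon> y z)) =
      f x - f y + \<epsilon> * (laplacian G f x - laplacian G f y)" for f
    \<comment> \<open>Integrating \<open>- f\<close> at \<open>y\<close> turns the difference of the
      two integrals into a sum.\<close>
    using infsumI[OF has_sum_add[OF has_sum_walk_measure[OF assms(1), of f \<epsilon>]
          has_sum_walk_measure[OF assms(2), of "\<lambda>z. - f z" \<epsilon>]]]
    by (simp add: laplacian_uminus algebra_simps)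
  then show ?thesis unfolding wasserstein_def by simp
qed

section \<open>Upper bounds for the curvature of an edge\<close>

lemma uminus_Lip1: "f \<in> Lip1 G \<Longrightarrow> (\<lambda>z. - f z) \<in> Lip1 G"
  by (auto simp: Lip1_def abs_minus_commute)

lemma curvature_le_laplacian_diff:
  assumes xy: "adj G x y" and f: "f \<in> Lip1 G" "bounded (f ` verts G)" and fxy: "f y - f x = 1"
  shows "curvature G x y \<le> laplacian G f x - laplacian G f y"
proof -
  let ?B = "{f \<in> Lip1 G. bounded (f ` verts G)}"
  define q where "q \<epsilon> f = f x - f y + \<epsilon> * (laplacian G f x - laplacian G f y)" for \<epsilon> and f :: "'a \<Rightarrow> real"
  define k where "k \<epsilon> = 1 / \<epsilon> * curvature_eps G \<epsilon> x y" for \<epsilon>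
  have v: "x \<in> verts G" "y \<in> verts G" using xy by (auto simp: adj_def)
  have d: "gdist G x y = 1" by (rule gdist_adj[OF xy])
  have k: "k \<epsilon> = 1 / \<epsilon> * (1 - (SUP f\<in>?B. q \<epsilon> f))" for \<epsilon>
    by (simp add: k_def curvature_eps_def wasserstein_walk_measure[OF v] d q_def)
  \<comment> \<open>At \<open>\<epsilon> = 0\<close> the objective is at most the distance between
    \<open>x\<close> and \<open>y\<close>, which is 1.\<close>
  have g1: "g x - g y \<le> 1" if "g \<in> ?B" for g
    using that v d by (force simp: Lip1_def)
  have bdd: "bdd_above (q \<epsilon> ` ?B)" if "\<epsilon> > 0" for \<epsilon>
  proof (rule bdd_aboveI2)
    fix g assume g: "g \<in> ?B"
    then have "laplacian G g x - laplacian G g y \<le> Deg G x + Deg G y"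
      using abs_laplacian_le_Deg[of x g] abs_laplacian_le_Deg[of y g] v by auto
    then have "\<epsilon> * (laplacian G g x - laplacian G g y) \<le> \<epsilon> * (Deg G x + Deg G y)"
      using that by (intro mult_left_mono) auto
    with g1[OF g] show "q \<epsilon> g \<le> 1 + \<epsilon> * (Deg G x + Deg G y)"
      unfolding q_def by linarith
  qed
  have fB: "(\<lambda>z. - f z) \<in> ?B"
    using f uminus_Lip1 by (auto simp: bounded_iff)
  have ub: "k \<epsilon> \<le> laplacian G f x - laplacian G f y" if "\<epsilon> > 0" for \<epsilon>
  proof -
    \<comment> \<open>The sign is reversed because the supremum favours functions larger at
      \<open>x\<close>, while \<open>f\<close> is larger at \<open>y\<close>.\<close>
    have "q \<epsilon> (\<lambda>z. - f z) \<le> (SUP f\<in>?B. q \<epsilon> f)"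
      using fB bdd[OF that] by (rule cSUP_upper)
    then show ?thesis using that fxy
      by (simp add: k q_def laplacian_uminus field_simps)
  qed
  have anti: "k t \<le> k s" if "0 < s" "s \<le> t" for s t
  proof -
    \<comment> \<open>Convexity: \<open>s\<close> combines 0 and \<open>t\<close> with weights
      \<open>1 - s / t\<close> and \<open>s / t\<close>, and the objective at 0 is at most 1 by
      \<open>g1\<close>.\<close>
    have "(SUP f\<in>?B. q s f) \<le> 1 - s / t * (1 - (SUP f\<in>?B. q t f))"
    proof (rule cSUP_least)
      fix g assume g: "g \<in> ?B"
      have "q t g \<le> (SUP f\<in>?B. q t f)"
        using g bdd that by (intro cSUP_upper) auto
      then have *: "s / t * q t g \<le> s / t * (SUP f\<in>?B. q t f)"
        using that by (intro mult_left_mono) auto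
      have "(1 - s / t) * (g x - g y) \<le> (1 - s / t) * 1"
        using g1[OF g] that by (intro mult_left_mono) auto
      moreover have "q s g = (1 - s / t) * (g x - g y) + s / t * q t g"
        using that by (simp add: q_def field_simps)
      ultimately show "q s g \<le> 1 - s / t * (1 - (SUP f\<in>?B. q t f))"
        using * by (simp add: algebra_simps)
    qed (use fB in blast)
    then show ?thesis using that by (simp add: k field_simps)
  qed
  have "(k \<longlongrightarrow> (SUP s\<in>{0<..}. k s)) (at_right 0)"
    using anti ub by (rule tendsto_at_right_SUP_antimono)
  then have "curvature G x y = (SUP s\<in>{0<..}. k s)"
    unfolding curvature_def k_def by (intro tendsto_Lim) auto
  also have "\<dots> \<le> laplacian G f x - laplacian G f y"
    using ub by (intro cSUP_least) auto
  finally show ?thesis .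
qed

lemma curvature_le_Deg_diff:
  assumes x0: "x0 \<in> verts G" and xy: "adj G x y" and r: "gdist G x0 y = gdist G x0 x + 1"
  shows "curvature G x y \<le>
    (Deg_plus G x0 x - Deg_minus G x0 x) - (Deg_plus G x0 y - Deg_minus G x0 y)"
proof -
  \<comment> \<open>Test functions must be bounded, so the distance is truncated. Neighbours of
    \<open>x\<close> and \<open>y\<close> lie within distance \<open>n\<close> of \<open>x0\<close>,
    so the truncation leaves both Laplacians unchanged.\<close>
  define n where "n = gdist G x0 y + 1"
  define f where "f z = real (min (gdist G x0 z) n)" for z
  have v: "x \<in> verts G" "y \<in> verts G" using xy by (auto simp: adj_def)
  have "f \<in> Lip1 G"
    unfolding Lip1_def
  proof (intro CollectI ballI)
    fix u w assume uw: "u \<in> verts G" "w \<in> verts G"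
    then show "\<bar>f u - f w\<bar> \<le> real (gdist G u w)"
      using gdist_triangle[OF x0, of u w] gdist_triangle[OF x0, of w u] gdist_sym[of u w]
      unfolding f_def by linarith
  qed
  moreover have "bounded (f ` verts G)"
    by (auto simp: bounded_iff f_def intro!: exI[of _ "real n"])
  moreover have "f y - f x = 1" using r by (simp add: f_def n_def)
  moreover have "laplacian G f z = laplacian G (\<lambda>z. real (gdist G x0 z)) z"
    if "gdist G x0 z \<le> gdist G x0 y" for z
    unfolding laplacian_def
  proof (intro arg_cong2[where f = "(/)"] sum.cong refl)
    fix u assume "u \<in> {u. adj G z u}"
    then have "gdist G x0 u \<le> gdist G x0 z + 1" using gdist_adj_le[OF x0] by simp
    with that show "weight G z u * (f u - f z) = weight G z u * (real (gdist G x0 u) - real (gdist G x0 z))"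
      by (simp add: f_def n_def)
  qed
  ultimately show ?thesis
    using curvature_le_laplacian_diff[OF xy, of f] r laplacian_gdist[OF x0] v by simp
qed

section \<open>Descent through the spheres\<close>

lemma sphere_curvature_le:
  assumes x0: "x0 \<in> verts G" and y: "y \<in> gsphere G x0 (Suc r)"
  obtains x where "x \<in> gsphere G x0 r"
    "sphere_curvature G x0 (Suc r) \<le>
       (Deg_plus G x0 x - Deg_minus G x0 x) - (Deg_plus G x0 y - Deg_minus G x0 y)"
proof -
  define P where "P = {x \<in> gsphere G x0 r. adj G x y}"
  have P: "finite P" "P \<noteq> {}"
    using finite_gsphere[OF x0] gsphere_predecessor[OF x0 y] unfolding P_def by (simp, blast)
  \<comment> \<open>The vertex \<open>x\<close> is a maximiser for this particular \<open>y\<close>;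
    the minimum defining the sphere curvature is at most the maximum belonging to
    \<open>y\<close>.\<close>
  then have "(MAX x\<in>P. curvature G x y) \<in> (\<lambda>x. curvature G x y) ` P"
    by (intro Max_in) auto
  then obtain x where x: "x \<in> P" "(MAX x\<in>P. curvature G x y) = curvature G x y"
    by (rule imageE)
  have "sphere_curvature G x0 (Suc r) \<le> (MAX x\<in>P. curvature G x y)"
    unfolding sphere_curvature_def P_def
    by (rule Min_le) (use finite_gsphere[OF x0] y in auto)
  also have "\<dots> \<le> (Deg_plus G x0 x - Deg_minus G x0 x) - (Deg_plus G x0 y - Deg_minus G x0 y)"
    unfolding x(2) using x(1) y by (intro curvature_le_Deg_diff[OF x0]) (auto simp: P_def gsphere_def)
  finally show ?thesis using that x(1) by (auto simp: P_def)
qed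

text \<open>Each descent step replaces the end point, hence the induction over arbitrary
  \<open>y\<close>. The terms at the intermediate vertices cancel, and at radius 0 only the degree
  of the centre is left.\<close>

lemma sum_sphere_curvature_le:
  assumes x0: "x0 \<in> verts G" and y: "y \<in> gsphere G x0 R"
  shows "(\<Sum>r=1..R. sphere_curvature G x0 r) \<le> Deg G x0 + (Deg_minus G x0 y - Deg_plus G x0 y)"
  using y
proof (induction R arbitrary: y)
  case 0
  then have "y = x0" using gdist_eq_0_iff[OF x0, of y] by (auto simp: gsphere_def)
  then show ?case by (simp add: Deg_plus_center[OF x0] Deg_minus_center)
next
  case (Suc R)
  obtain x where "x \<in> gsphere G x0 R" and
    "sphere_curvature G x0 (Suc R) \<le>
       (Deg_plus G x0 x - Deg_minus G x0 x) - (Deg_plus G x0 y - Deg_minus G x0 y)"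
    using sphere_curvature_le[OF x0 Suc.prems] by blast
  with Suc.IH[of x] show ?case by simp
qed

lemma sum_sphere_curvature_le_Min:
  assumes x0: "x0 \<in> verts G" and ne: "gsphere G x0 R \<noteq> {}"
  shows "(\<Sum>r=1..R. sphere_curvature G x0 r)
    \<le> Deg G x0 + (MIN x\<in>gsphere G x0 R. Deg_minus G x0 x - Deg_plus G x0 x)"
proof -
  have "(MIN x\<in>gsphere G x0 R. Deg_minus G x0 x - Deg_plus G x0 x)
      \<in> (\<lambda>x. Deg_minus G x0 x - Deg_plus G x0 x) ` gsphere G x0 R"
    using finite_gsphere[OF x0] ne by (intro Min_in) auto
  then obtain y where "y \<in> gsphere G x0 R"
    "(MIN x\<in>gsphere G x0 R. Deg_minus G x0 x - Deg_plus G x0 x) = Deg_minus G x0 y - Deg_plus G x0 y"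
    by (rule imageE)
  with sum_sphere_curvature_le[OF x0] show ?thesis by simp
qed

section \<open>The diameter bound\<close>

lemma diam_le:
  assumes x0: "x0 \<in> verts G" and ecc: "\<And>x. x \<in> verts G \<Longrightarrow> real (gdist G x0 x) \<le> c"
  shows "diam G \<le> ereal (2 * c)"
  unfolding diam_def
proof (intro SUP_least)
  fix x y assume xy: "x \<in> verts G" "y \<in> verts G"
  then have "gdist G x y \<le> gdist G x0 x + gdist G x0 y"
    using gdist_triangle[of x x0 y] gdist_sym[of x x0] x0 by simp
  with ecc[OF xy(1)] ecc[OF xy(2)] show "ereal (real (gdist G x y)) \<le> ereal (2 * c)" by simp
qed

lemma diam_le_of_sphere_curvature_ge:
  assumes x0: "x0 \<in> verts G" and z: "z \<in> verts G" "z \<noteq> x0" and K: "K > 0"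
    and M: "\<And>r. \<lbrakk>r \<ge> 1; gsphere G x0 r \<noteq> {}\<rbrakk> \<Longrightarrow>
        (MIN x\<in>gsphere G x0 r. Deg_minus G x0 x - Deg_plus G x0 x) \<le> M"
    and \<kappa>: "\<And>r. \<lbrakk>r \<ge> 1; gsphere G x0 r \<noteq> {}\<rbrakk> \<Longrightarrow> sphere_curvature G x0 r \<ge> K"
  shows "diam G \<le> ereal (2 * (Deg G x0 + M) / K)"
proof -
  \<comment> \<open>Predecessors exist on every smaller sphere, so the lower bound on the curvature
    applies to each summand up to \<open>R\<close>.\<close>
  have ne: "gsphere G x0 r \<noteq> {}" if "gsphere G x0 R \<noteq> {}" "r \<le> R" for r R
    using that(2,1)
  proof (induction rule: inc_induct)
    case (step n)
    then show ?case using gsphere_predecessor[OF x0] by blast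
  qed
  \<comment> \<open>The centre is left out because \<open>M\<close> is controlled only on spheres of
    radius at least 1.\<close>
  have R: "K * real (gdist G x0 x) \<le> Deg G x0 + M" if "x \<in> verts G" "x \<noteq> x0" for x
  proof -
    let ?R = "gdist G x0 x"
    have S: "gsphere G x0 ?R \<noteq> {}" using that by (auto simp: gsphere_def)
    have "?R \<ge> 1" using gdist_eq_0_iff[OF x0 that(1)] that(2) by (simp add: Suc_le_eq)
    have "K * real ?R = (\<Sum>r=1..?R. K)" by simp
    also have "\<dots> \<le> (\<Sum>r=1..?R. sphere_curvature G x0 r)"
      by (intro sum_mono \<kappa> ne[OF S]) auto
    also have "\<dots> \<le> Deg G x0 + M"
      using sum_sphere_curvature_le_Min[OF x0 S] M[OF \<open>?R \<ge> 1\<close> S] by linarith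
    finally show ?thesis .
  qed
  \<comment> \<open>The second vertex \<open>z\<close> forces \<open>Deg G x0 + M\<close> to be
    nonnegative, which settles the remaining case \<open>x = x0\<close>.\<close>
  have "K * real (gdist G x0 z) \<ge> 0" using K by simp
  with R[OF z] have "Deg G x0 + M \<ge> 0" by linarith
  then have "real (gdist G x0 x) \<le> (Deg G x0 + M) / K" if "x \<in> verts G" for x
    using R[OF that] K by (cases "x = x0") (auto simp: field_simps)
  from diam_le[OF x0 this] show ?thesis by simp
qed

end

theorem theorem4p15:
  fixes G :: "'a wgraph" and x0 :: 'a
  assumes "weighted_graph G"
    and "\<exists>x\<in>verts G. \<exists>y\<in>verts G. x \<noteq> y"
    and "x0 \<in> verts G"
  shows "(\<forall>R>0. gsphere G x0 R \<noteq> {} \<longrightarrow>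
            (\<Sum>r=1..R. sphere_curvature G x0 r)
              \<le> Deg G x0 + (MIN x\<in>gsphere G x0 R. Deg_minus G x0 x - Deg_plus G x0 x))
       \<and> (\<forall>M K :: real. K > 0 \<longrightarrow>
            (\<forall>r\<ge>1. gsphere G x0 r \<noteq> {} \<longrightarrow>
               (MIN x\<in>gsphere G x0 r. Deg_minus G x0 x - Deg_plus G x0 x) \<le> M
               \<and> sphere_curvature G x0 r \<ge> K) \<longrightarrow>
            diam G \<le> ereal (2 * (Deg G x0 + M) / K))"
proof -
  interpret weighted_graph G by fact
  obtain z where "z \<in> verts G" "z \<noteq> x0" using assms(2) by metis
  then show ?thesis
    using sum_sphere_curvature_le_Min[OF assms(3)] diam_le_of_sphere_curvature_ge[OF assms(3)]
    by blast
qed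

end
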